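(* Let $n\ge 1$ be an integer, let $\mu=\mu_{1/(2n)}$ be the Bernoulli convolution measure with scale factor $\frac{1}{2n}$, and suppose that the canonical family $E(\Gamma)=\{e_\gamma:\gamma\in\Gamma\}$ is an orthonormal basis of $L^2(\mu)$. Let $S_0,S_1$ be the isometries of $L^2(\mu)$ determined by $S_0e_\gamma=e_{2n\gamma}$ and $S_1e_\gamma=e_{\frac n2+2n\gamma}$ for $\gamma\in\Gamma$, and put $W_k=S_0^kS_1(L^2(\mu))$ for $k=0,1,2,\dots$. Then $L^2(\mu)$ is the orthogonal direct sum $$L^2(\mu)=\mathrm{sp}\{e_0\}\oplus\bigoplus_{k=0}^\infty W_k .$$
   Context: For $\lambda\in(0,1)$, $\mu_\lambda$ is the unique Borel probability measure on $\mathbb{R}$ satisfying $\mu_\lambda=\frac12\mu_\lambda\circ\tau_+^{-1}+\frac12\mu_\lambda\circ\tau_-^{-1}$, where $\tau_\pm(x)=\lambda(x\pm1)$; it is compactly supported. Here $\lambda=\frac1{2n}$ and $\mu=\mu_{1/(2n)}$. For $t\in\mathbb{R}$, $e_t(x)=e^{2\pi i t x}$, regarded as an element of $L^2(\mu)$. The canonical index set is $\Gamma=\{\sum_{i=0}^m a_i(2n)^i: m\ge0,\ a_i\in\{0,\frac n2\}\}$. It satisfies $\Gamma=2n\Gamma\sqcup(\frac n2+2n\Gamma)$. $\mathrm{sp}$ denotes linear span; the infinite direct sum is the closed (Hilbert space) orthogonal direct sum. *)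

theory Defs
  imports "HOL-Probability.Probability"
begin

definition bernoulli_convolution :: "real \<Rightarrow> real measure \<Rightarrow> bool" where
  "bernoulli_convolution lam M \<longleftrightarrow>
     prob_space M \<and> sets M = sets borel \<and>
     (\<forall>A\<in>sets borel.
        measure M A = 1/2 * measure M ((\<lambda>x. lam * (x + 1)) -` A)
                    + 1/2 * measure M ((\<lambda>x. lam * (x - 1)) -` A))"

text \<open>
  The space \<open>L\<^sup>2(M)\<close> of complex-valued functions.  Its elements are the classes, modulo
  equality almost everywhere, of square-integrable functions.  Since \<open>M\<close> is a term, the space
  is a carrier set rather than a type.  The vector space operations and the inner product are
  computed on chosen representatives; the lemmas below show that the choice is immaterial.
\<close>

definition l2_fun :: "'a measure \<Rightarrow> ('a \<Rightarrow> complex) set" where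
  "l2_fun M = {f \<in> borel_measurable M. integrable M (\<lambda>x. (cmod (f x))\<^sup>2)}"

definition l2_cls :: "'a measure \<Rightarrow> ('a \<Rightarrow> complex) \<Rightarrow> ('a \<Rightarrow> complex) set" where
  "l2_cls M f = {g \<in> l2_fun M. AE x in M. g x = f x}"

definition L2 :: "'a measure \<Rightarrow> ('a \<Rightarrow> complex) set set" where
  "L2 M = l2_cls M ` l2_fun M"

definition l2_rep :: "('a \<Rightarrow> complex) set \<Rightarrow> 'a \<Rightarrow> complex" where
  "l2_rep u = (SOME f. f \<in> u)"

definition l2_zero :: "'a measure \<Rightarrow> ('a \<Rightarrow> complex) set" where
  "l2_zero M = l2_cls M (\<lambda>_. 0)"

definition l2_add ::
    "'a measure \<Rightarrow> ('a \<Rightarrow> complex) set \<Rightarrow> ('a \<Rightarrow> complex) set \<Rightarrow> ('a \<Rightarrow> complex) set" where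
  "l2_add M u v = l2_cls M (\<lambda>x. l2_rep u x + l2_rep v x)"

definition l2_scale ::
    "'a measure \<Rightarrow> complex \<Rightarrow> ('a \<Rightarrow> complex) set \<Rightarrow> ('a \<Rightarrow> complex) set" where
  "l2_scale M c u = l2_cls M (\<lambda>x. c * l2_rep u x)"

definition l2_inner ::
    "'a measure \<Rightarrow> ('a \<Rightarrow> complex) set \<Rightarrow> ('a \<Rightarrow> complex) set \<Rightarrow> complex" where
  "l2_inner M u v = (LINT x|M. l2_rep u x * cnj (l2_rep v x))"

definition l2_norm :: "'a measure \<Rightarrow> ('a \<Rightarrow> complex) set \<Rightarrow> real" where
  "l2_norm M u = sqrt (Re (l2_inner M u u))"

definition l2_dist ::
    "'a measure \<Rightarrow> ('a \<Rightarrow> complex) set \<Rightarrow> ('a \<Rightarrow> complex) set \<Rightarrow> real" where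
  "l2_dist M u v = l2_norm M (l2_add M u (l2_scale M (-1) v))"

lemma l2_fun_add:
  assumes "f \<in> l2_fun M" "g \<in> l2_fun M"
  shows "(\<lambda>x. f x + g x) \<in> l2_fun M"
proof -
  have [measurable]: "f \<in> borel_measurable M" "g \<in> borel_measurable M"
    using assms by (auto simp: l2_fun_def)
  have bound: "(cmod (a + b))\<^sup>2 \<le> 2 * (cmod a)\<^sup>2 + 2 * (cmod b)\<^sup>2" for a b
  proof -
    have "(cmod (a + b))\<^sup>2 \<le> (cmod a + cmod b)\<^sup>2"
      by (intro power_mono norm_triangle_ineq) auto
    also have "\<dots> \<le> 2 * (cmod a)\<^sup>2 + 2 * (cmod b)\<^sup>2"
      using sum_squares_bound[of "cmod a" "cmod b"] by (simp add: power2_sum)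
    finally show ?thesis .
  qed
  have "integrable M (\<lambda>x. 2 * (cmod (f x))\<^sup>2 + 2 * (cmod (g x))\<^sup>2)"
    using assms by (auto simp: l2_fun_def)
  then have "integrable M (\<lambda>x. (cmod (f x + g x))\<^sup>2)"
    by (rule Bochner_Integration.integrable_bound) (use bound in auto)
  then show ?thesis by (auto simp: l2_fun_def)
qed

lemma l2_fun_scale: "f \<in> l2_fun M \<Longrightarrow> (\<lambda>x. c * f x) \<in> l2_fun M"
  by (auto simp: l2_fun_def norm_mult power_mult_distrib)

lemma l2_rep_cls:
  assumes "f \<in> l2_fun M"
  shows "l2_rep (l2_cls M f) \<in> l2_fun M" "AE x in M. l2_rep (l2_cls M f) x = f x"
proof -
  have "f \<in> l2_cls M f" using assms by (simp add: l2_cls_def)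
  then have "l2_rep (l2_cls M f) \<in> l2_cls M f"
    unfolding l2_rep_def by (metis someI_ex)
  then show "l2_rep (l2_cls M f) \<in> l2_fun M" "AE x in M. l2_rep (l2_cls M f) x = f x"
    by (auto simp: l2_cls_def)
qed

lemma l2_cls_cong:
  assumes "AE x in M. f x = g x"
  shows "l2_cls M f = l2_cls M g"
proof -
  have "(AE x in M. h x = f x) \<longleftrightarrow> (AE x in M. h x = g x)" for h
    using assms by (intro eventually_cong) auto
  then show ?thesis by (simp add: l2_cls_def)
qed

lemma l2_add_cls:
  assumes "f \<in> l2_fun M" "g \<in> l2_fun M"
  shows "l2_add M (l2_cls M f) (l2_cls M g) = l2_cls M (\<lambda>x. f x + g x)"
  unfolding l2_add_def
  using l2_rep_cls(2)[OF assms(1)] l2_rep_cls(2)[OF assms(2)]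
  by (intro l2_cls_cong) auto

lemma l2_scale_cls:
  assumes "f \<in> l2_fun M"
  shows "l2_scale M c (l2_cls M f) = l2_cls M (\<lambda>x. c * f x)"
  unfolding l2_scale_def
  using l2_rep_cls(2)[OF assms] by (intro l2_cls_cong) auto

lemma l2_inner_cls:
  assumes "f \<in> l2_fun M" "g \<in> l2_fun M"
  shows "l2_inner M (l2_cls M f) (l2_cls M g) = (LINT x|M. f x * cnj (g x))"
proof -
  have [measurable]: "f \<in> borel_measurable M" "g \<in> borel_measurable M"
    "l2_rep (l2_cls M f) \<in> borel_measurable M" "l2_rep (l2_cls M g) \<in> borel_measurable M"
    using assms l2_rep_cls(1)[OF assms(1)] l2_rep_cls(1)[OF assms(2)]
    by (auto simp: l2_fun_def)
  have "cnj \<in> borel_measurable borel"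
    by (intro borel_measurable_continuous_onI continuous_intros)
  note [measurable] = this
  show ?thesis
    unfolding l2_inner_def
    by (intro integral_cong_AE; (measurable)?)
       (use l2_rep_cls(2)[OF assms(1)] l2_rep_cls(2)[OF assms(2)] in auto)
qed

definition l2_subspace :: "'a measure \<Rightarrow> ('a \<Rightarrow> complex) set set \<Rightarrow> bool" where
  "l2_subspace M V \<longleftrightarrow>
     V \<subseteq> L2 M \<and> l2_zero M \<in> V \<and>
     (\<forall>u\<in>V. \<forall>v\<in>V. l2_add M u v \<in> V) \<and> (\<forall>c. \<forall>u\<in>V. l2_scale M c u \<in> V)"

definition l2_span :: "'a measure \<Rightarrow> ('a \<Rightarrow> complex) set set \<Rightarrow> ('a \<Rightarrow> complex) set set" where
  "l2_span M B = \<Inter>{V. l2_subspace M V \<and> B \<subseteq> V}"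

definition l2_closure :: "'a measure \<Rightarrow> ('a \<Rightarrow> complex) set set \<Rightarrow> ('a \<Rightarrow> complex) set set" where
  "l2_closure M V = {u \<in> L2 M. \<forall>\<epsilon>>0. \<exists>v\<in>V. l2_dist M u v < \<epsilon>}"

definition l2_orthonormal_basis ::
    "'a measure \<Rightarrow> 'i set \<Rightarrow> ('i \<Rightarrow> ('a \<Rightarrow> complex) set) \<Rightarrow> bool" where
  "l2_orthonormal_basis M I b \<longleftrightarrow>
     (\<forall>i\<in>I. b i \<in> L2 M) \<and>
     (\<forall>i\<in>I. \<forall>j\<in>I. l2_inner M (b i) (b j) = (if i = j then 1 else 0)) \<and>
     l2_closure M (l2_span M (b ` I)) = L2 M"

definition l2_isometry ::
    "'a measure \<Rightarrow> (('a \<Rightarrow> complex) set \<Rightarrow> ('a \<Rightarrow> complex) set) \<Rightarrow> bool" where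
  "l2_isometry M S \<longleftrightarrow>
     (\<forall>u\<in>L2 M. S u \<in> L2 M) \<and>
     (\<forall>u\<in>L2 M. \<forall>v\<in>L2 M. S (l2_add M u v) = l2_add M (S u) (S v)) \<and>
     (\<forall>c. \<forall>u\<in>L2 M. S (l2_scale M c u) = l2_scale M c (S u)) \<and>
     (\<forall>u\<in>L2 M. l2_norm M (S u) = l2_norm M u)"

text \<open>
  \<open>H\<close> is the Hilbert space (internal) orthogonal direct sum of the family \<open>V\<close>: the \<open>V i\<close> are
  closed subspaces, mutually orthogonal, and \<open>H\<close> is the closure of their algebraic sum.
\<close>

definition l2_orthogonal_direct_sum ::
    "'a measure \<Rightarrow> ('a \<Rightarrow> complex) set set \<Rightarrow> ('i \<Rightarrow> ('a \<Rightarrow> complex) set set) \<Rightarrow> bool" where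
  "l2_orthogonal_direct_sum M H V \<longleftrightarrow>
     (\<forall>i. l2_subspace M (V i) \<and> l2_closure M (V i) = V i) \<and>
     (\<forall>i j. i \<noteq> j \<longrightarrow> (\<forall>u\<in>V i. \<forall>v\<in>V j. l2_inner M u v = 0)) \<and>
     H = l2_closure M (l2_span M (\<Union>i. V i))"

definition l2_exp :: "real measure \<Rightarrow> real \<Rightarrow> (real \<Rightarrow> complex) set" where
  "l2_exp M t = l2_cls M (\<lambda>x. exp (2 * of_real pi * \<i> * of_real t * of_real x))"

definition canonical_index_set :: "nat \<Rightarrow> real set" where
  "canonical_index_set n =
     {(\<Sum>i=0..m. a i * (2 * real n) ^ i) | m a. \<forall>i\<le>m. a i \<in> {0, real n / 2}}"

end

theory Submission
  imports Defs
begin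

text \<open>
  The canonical index set splits as \<open>\<Gamma> = 2n\<Gamma> \<squnion> (n/2 + 2n\<Gamma>)\<close>, so by density of the exponentials the
  ranges of \<open>S\<^sub>0\<close> and \<open>S\<^sub>1\<close> are orthogonal.  For \<open>j < k\<close>, cancelling the isometry \<open>S\<^sub>0\<^sup>j\<close> reduces
  \<open>W\<^sub>j \<bottom> W\<^sub>k\<close> to this, and likewise \<open>e\<^sub>0 \<bottom> W\<^sub>j\<close> because \<open>S\<^sub>0\<close> fixes \<open>e\<^sub>0\<close>.  Splitting off the
  factors \<open>2n\<close>, every \<open>\<gamma> \<noteq> 0\<close> in \<open>\<Gamma>\<close> has the form \<open>(2n)\<^sup>k(n/2 + 2n\<delta>)\<close> with \<open>\<delta> \<in> \<Gamma>\<close>, so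
  that \<open>e\<^sub>\<gamma> = S\<^sub>0\<^sup>kS\<^sub>1e\<^sub>\<delta>\<close> lies in \<open>W\<^sub>k\<close>.  The \<open>W\<^sub>k\<close> are closed as isometric images of a complete
  space; completeness is the Riesz-Fischer theorem, obtained from an almost everywhere convergent
  subsequence and Fatou's lemma.
\<close>

section \<open>Linear structure, inner product and norm of the space of classes\<close>

lemma l2_cls_in_L2: "f \<in> l2_fun M \<Longrightarrow> l2_cls M f \<in> L2 M"
  by (simp add: L2_def)

lemma L2_cases:
  assumes "u \<in> L2 M"
  obtains f where "f \<in> l2_fun M" "u = l2_cls M f"
  using assms by (auto simp: L2_def)

text \<open>The product is dominated by |f|^2 + |g|^2. This integrability is what lets the integral,
  and hence the inner product, split over sums.\<close>

lemma l2_fun_mult_integrable: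
  assumes "f \<in> l2_fun M" "g \<in> l2_fun M"
  shows "integrable M (\<lambda>x. f x * cnj (g x))"
proof -
  have [measurable]: "f \<in> borel_measurable M" "g \<in> borel_measurable M" "cnj \<in> borel_measurable borel"
    using assms by (auto simp: l2_fun_def intro!: borel_measurable_continuous_onI continuous_intros)
  have "integrable M (\<lambda>x. (cmod (f x))\<^sup>2 + (cmod (g x))\<^sup>2)"
    using assms by (auto simp: l2_fun_def)
  then show ?thesis
  proof (rule Bochner_Integration.integrable_bound)
    have "cmod a * cmod b \<le> (cmod a)\<^sup>2 + (cmod b)\<^sup>2" for a b
      using sum_squares_bound[of "cmod a" "cmod b"]
        mult_nonneg_nonneg[OF norm_ge_zero[of a] norm_ge_zero[of b]] by linarith
    then show "AE x in M. norm (f x * cnj (g x)) \<le> norm ((cmod (f x))\<^sup>2 + (cmod (g x))\<^sup>2)"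
      by (simp add: norm_mult)
  qed measurable
qed

lemma l2_fun_uminus: "f \<in> l2_fun M \<Longrightarrow> (\<lambda>x. - f x) \<in> l2_fun M"
  using l2_fun_scale[of f M "-1"] by simp

lemma l2_fun_diff: "f \<in> l2_fun M \<Longrightarrow> g \<in> l2_fun M \<Longrightarrow> (\<lambda>x. f x - g x) \<in> l2_fun M"
  using l2_fun_add[OF _ l2_fun_uminus, of f M g] by simp

lemma l2_zero_fun [simp]: "(\<lambda>_. 0) \<in> l2_fun M"
  by (simp add: l2_fun_def)

lemma l2_zero_in_L2 [simp]: "l2_zero M \<in> L2 M"
  by (simp add: l2_zero_def l2_cls_in_L2)

lemma l2_add_in_L2 [simp]: "u \<in> L2 M \<Longrightarrow> v \<in> L2 M \<Longrightarrow> l2_add M u v \<in> L2 M"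
  by (elim L2_cases) (simp add: l2_add_cls l2_fun_add l2_cls_in_L2)

lemma l2_scale_in_L2 [simp]: "u \<in> L2 M \<Longrightarrow> l2_scale M c u \<in> L2 M"
  by (elim L2_cases) (simp add: l2_scale_cls l2_fun_scale l2_cls_in_L2)

lemma l2_inner_add_left:
  "u \<in> L2 M \<Longrightarrow> v \<in> L2 M \<Longrightarrow> w \<in> L2 M \<Longrightarrow>
    l2_inner M (l2_add M u v) w = l2_inner M u w + l2_inner M v w"
  by (elim L2_cases)
    (simp add: l2_add_cls l2_fun_add l2_inner_cls distrib_right l2_fun_mult_integrable)

lemma l2_inner_scale_left:
  "u \<in> L2 M \<Longrightarrow> w \<in> L2 M \<Longrightarrow> l2_inner M (l2_scale M c u) w = c * l2_inner M u w"
  by (elim L2_cases)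
    (simp add: l2_scale_cls l2_fun_scale l2_inner_cls mult.assoc)

text \<open>Both sides integrate the same chosen representatives, so this is conjugation under the
  integral sign.\<close>

lemma l2_inner_commute: "l2_inner M v u = cnj (l2_inner M u v)"
proof -
  have "l2_inner M v u = (LINT x|M. cnj (l2_rep u x * cnj (l2_rep v x)))"
    unfolding l2_inner_def by (simp add: mult.commute)
  then show ?thesis
    unfolding l2_inner_def by (simp only: Bochner_Integration.integral_cnj)
qed

lemma l2_inner_add_right:
  "u \<in> L2 M \<Longrightarrow> v \<in> L2 M \<Longrightarrow> w \<in> L2 M \<Longrightarrow>
    l2_inner M w (l2_add M u v) = l2_inner M w u + l2_inner M w v"
  using l2_inner_add_left[of u M v w] by (simp add: l2_inner_commute[of M w])

lemma l2_inner_scale_right: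
  "u \<in> L2 M \<Longrightarrow> w \<in> L2 M \<Longrightarrow> l2_inner M w (l2_scale M c u) = cnj c * l2_inner M w u"
  using l2_inner_scale_left[of u M w c] by (simp add: l2_inner_commute[of M w])

lemmas l2_inner_simps =
  l2_inner_add_left l2_inner_add_right l2_inner_scale_left l2_inner_scale_right

lemma l2_inner_self_integral: "l2_inner M u u = of_real (LINT x|M. (cmod (l2_rep u x))\<^sup>2)"
  unfolding l2_inner_def by (subst integral_complex_of_real[symmetric]) (simp only: complex_norm_square)

lemma l2_inner_self: "l2_inner M u u = of_real ((l2_norm M u)\<^sup>2)"
  by (simp add: l2_norm_def l2_inner_self_integral)

lemma l2_norm_nonneg [simp]: "0 \<le> l2_norm M u"
  by (simp add: l2_norm_def l2_inner_self_integral)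

lemma l2_norm_cls: "f \<in> l2_fun M \<Longrightarrow> (l2_norm M (l2_cls M f))\<^sup>2 = (LINT x|M. (cmod (f x))\<^sup>2)"
proof -
  assume "f \<in> l2_fun M"
  then have "complex_of_real ((l2_norm M (l2_cls M f))\<^sup>2) = of_real (LINT x|M. (cmod (f x))\<^sup>2)"
    unfolding l2_inner_self[symmetric]
    by (subst integral_complex_of_real[symmetric]) (simp only: complex_norm_square l2_inner_cls)
  then show ?thesis
    using of_real_eq_iff by blast
qed

lemma l2_norm_scale: "u \<in> L2 M \<Longrightarrow> l2_norm M (l2_scale M c u) = cmod c * l2_norm M u"
proof -
  assume "u \<in> L2 M"
  then have "complex_of_real ((l2_norm M (l2_scale M c u))\<^sup>2) = of_real ((cmod c * l2_norm M u)\<^sup>2)"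
    unfolding l2_inner_self[symmetric]
    using complex_norm_square[of c]
    by (simp add: l2_inner_simps) (simp add: l2_inner_self power_mult_distrib mult_ac)
  then have "(l2_norm M (l2_scale M c u))\<^sup>2 = (cmod c * l2_norm M u)\<^sup>2"
    using of_real_eq_iff by blast
  then show ?thesis
    by (simp add: power2_eq_iff_nonneg)
qed

text \<open>The two cross terms are conjugate to each other. The expansion drives Cauchy-Schwarz,
  the triangle inequality and the polarization argument for isometries.\<close>

lemma l2_norm_add_squared:
  assumes "u \<in> L2 M" "v \<in> L2 M"
  shows "(l2_norm M (l2_add M u v))\<^sup>2 = (l2_norm M u)\<^sup>2 + 2 * Re (l2_inner M u v) + (l2_norm M v)\<^sup>2"
proof -
  have "complex_of_real ((l2_norm M (l2_add M u v))\<^sup>2) =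
      of_real ((l2_norm M u)\<^sup>2) + (l2_inner M u v + cnj (l2_inner M u v)) + of_real ((l2_norm M v)\<^sup>2)"
    unfolding l2_inner_self[symmetric] using assms
    by (simp add: l2_inner_simps l2_inner_commute[of M v u])
  also have "\<dots> = of_real ((l2_norm M u)\<^sup>2 + 2 * Re (l2_inner M u v) + (l2_norm M v)\<^sup>2)"
    by (simp add: complex_add_cnj)
  finally show ?thesis
    using of_real_eq_iff by blast
qed

text \<open>With \<open>a\<close> the inner product of \<open>u\<close> and \<open>v\<close>, the
  squared norm of u - t a v is a quadratic in the real parameter t that is never negative; a
  suitable t gives the bound.\<close>

lemma l2_Cauchy_Schwarz:
  assumes "u \<in> L2 M" "v \<in> L2 M"
  shows "cmod (l2_inner M u v) \<le> l2_norm M u * l2_norm M v"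
proof -
  define a where "a = l2_inner M u v"
  have key: "0 \<le> (l2_norm M u)\<^sup>2 - 2 * t * (cmod a)\<^sup>2 + t\<^sup>2 * (cmod a)\<^sup>2 * (l2_norm M v)\<^sup>2" for t
  proof -
    have "0 \<le> (l2_norm M (l2_add M u (l2_scale M (- of_real t * a) v)))\<^sup>2"
      by simp
    also have "\<dots> = (l2_norm M u)\<^sup>2 - 2 * t * (cmod a)\<^sup>2 + t\<^sup>2 * (cmod a)\<^sup>2 * (l2_norm M v)\<^sup>2"
    proof -
      \<comment> \<open>The factor \<open>a\<close> in the coefficient makes the cross term
        real.\<close>
      have "cnj (- of_real t * a) * a = of_real (- t * (cmod a)\<^sup>2)"
        using complex_norm_square[of a] by (simp add: mult.commute mult.left_commute)
      then have "Re (cnj (- of_real t * a) * a) = - t * (cmod a)\<^sup>2"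
        by (metis Re_complex_of_real)
      then show ?thesis
        using assms by (simp add: l2_norm_add_squared l2_inner_simps l2_norm_scale norm_mult
          power_mult_distrib flip: a_def)
    qed
    finally show ?thesis .
  qed
  have "(cmod a)\<^sup>2 \<le> (l2_norm M u)\<^sup>2 * (l2_norm M v)\<^sup>2"
  proof (cases "l2_norm M v = 0")
    case True
    show ?thesis
    proof (rule ccontr)
      assume "\<not> ?thesis"
      then have "0 < (cmod a)\<^sup>2" using True by simp
      \<comment> \<open>Here the quadratic degenerates to an affine function of t; the chosen t
        makes it equal to -|u|^2 - 2 < 0.\<close>
      then show False
        using key[of "((l2_norm M u)\<^sup>2 + 1) / (cmod a)\<^sup>2"] True zero_le_power2[of "l2_norm M u"]
        by (simp del: zero_le_power2)
    qed
  next
    case False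
    then have "0 < (l2_norm M v)\<^sup>2" by simp
    moreover from this have "(1 / (l2_norm M v)\<^sup>2)\<^sup>2 * (cmod a)\<^sup>2 * (l2_norm M v)\<^sup>2 = (cmod a)\<^sup>2 / (l2_norm M v)\<^sup>2"
      by (simp add: power2_eq_square)
    \<comment> \<open>The value 1 / |v|^2 of t is the minimizer of the quadratic.\<close>
    ultimately have "(cmod a)\<^sup>2 / (l2_norm M v)\<^sup>2 \<le> (l2_norm M u)\<^sup>2"
      using key[of "1 / (l2_norm M v)\<^sup>2"] by simp
    with \<open>0 < (l2_norm M v)\<^sup>2\<close> show ?thesis
      by (simp add: pos_divide_le_eq)
  qed
  then show ?thesis
    unfolding a_def by - (rule power2_le_imp_le, simp_all add: power_mult_distrib)
qed

lemma l2_norm_triangle: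
  assumes "u \<in> L2 M" "v \<in> L2 M"
  shows "l2_norm M (l2_add M u v) \<le> l2_norm M u + l2_norm M v"
proof (rule power2_le_imp_le)
  have "Re (l2_inner M u v) \<le> l2_norm M u * l2_norm M v"
    using l2_Cauchy_Schwarz[OF assms] complex_Re_le_cmod[of "l2_inner M u v"] by linarith
  then show "(l2_norm M (l2_add M u v))\<^sup>2 \<le> (l2_norm M u + l2_norm M v)\<^sup>2"
    using assms by (simp add: l2_norm_add_squared power2_sum)
qed simp

section \<open>Distance, closure and span\<close>

lemma l2_dist_cls:
  assumes "f \<in> l2_fun M" "g \<in> l2_fun M"
  shows "(l2_dist M (l2_cls M f) (l2_cls M g))\<^sup>2 = (LINT x|M. (cmod (f x - g x))\<^sup>2)"
  using assms by (simp add: l2_dist_def l2_scale_cls l2_add_cls l2_fun_uminus l2_fun_diff l2_norm_cls)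

lemma l2_dist_nonneg [simp]: "0 \<le> l2_dist M u v"
  by (simp add: l2_dist_def)

lemma l2_dist_commute: "u \<in> L2 M \<Longrightarrow> v \<in> L2 M \<Longrightarrow> l2_dist M u v = l2_dist M v u"
  by (elim L2_cases, rule power2_eq_imp_eq) (simp_all add: l2_dist_cls norm_minus_commute)

lemma l2_dist_triangle:
  assumes "u \<in> L2 M" "v \<in> L2 M" "w \<in> L2 M"
  shows "l2_dist M u w \<le> l2_dist M u v + l2_dist M v w"
proof -
  have "l2_add M u (l2_scale M (-1) w) =
      l2_add M (l2_add M u (l2_scale M (-1) v)) (l2_add M v (l2_scale M (-1) w))"
    using assms
    by (elim L2_cases) (simp add: l2_add_cls l2_scale_cls l2_fun_uminus l2_fun_diff)
  then show ?thesis
    using assms l2_norm_triangle[of "l2_add M u (l2_scale M (-1) v)" M "l2_add M v (l2_scale M (-1) w)"]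
    by (simp add: l2_dist_def)
qed

text \<open>A nonnegative function with integral zero vanishes almost everywhere, and almost
  everywhere equal functions have the same class.\<close>

lemma l2_dist_eq_0D:
  assumes "u \<in> L2 M" "v \<in> L2 M" "l2_dist M u v = 0"
  shows "u = v"
proof -
  obtain f g where fg: "f \<in> l2_fun M" "u = l2_cls M f" "g \<in> l2_fun M" "v = l2_cls M g"
    using assms by (elim L2_cases) auto
  have "integrable M (\<lambda>x. (cmod (f x - g x))\<^sup>2)"
    using l2_fun_diff[OF fg(1,3)] by (simp add: l2_fun_def)
  moreover have "(LINT x|M. (cmod (f x - g x))\<^sup>2) = 0"
    using l2_dist_cls[OF fg(1,3)] assms(3) fg by simp
  ultimately have "AE x in M. f x = g x"
    by (simp add: integral_nonneg_eq_0_iff_AE)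
  then show ?thesis
    using fg l2_cls_cong by auto
qed

lemma l2_closureI:
  "u \<in> L2 M \<Longrightarrow> (\<And>\<epsilon>. \<epsilon> > 0 \<Longrightarrow> \<exists>v\<in>V. l2_dist M u v < \<epsilon>) \<Longrightarrow> u \<in> l2_closure M V"
  by (simp add: l2_closure_def)

lemma l2_closure_mono: "V \<subseteq> W \<Longrightarrow> l2_closure M V \<subseteq> l2_closure M W"
  unfolding l2_closure_def by blast

lemma l2_dist_self: "u \<in> L2 M \<Longrightarrow> l2_dist M u u = 0"
  using power_eq_0_iff[of "l2_dist M u u" 2] by (elim L2_cases) (simp add: l2_dist_cls)

lemma l2_subset_closure: "V \<subseteq> L2 M \<Longrightarrow> V \<subseteq> l2_closure M V"
proof
  fix u assume "V \<subseteq> L2 M" "u \<in> V"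
  moreover from this have "l2_dist M u u = 0"
    by (intro l2_dist_self) auto
  ultimately show "u \<in> l2_closure M V"
    by (intro l2_closureI bexI[of _ u]) auto
qed

lemma l2_subspace_L2: "l2_subspace M (L2 M)"
  by (simp add: l2_subspace_def)

text \<open>The hypothesis makes \<open>L2 M\<close> one of the subspaces being intersected, which
  keeps the intersection inside \<open>L2 M\<close>.\<close>

lemma l2_subspace_span: "B \<subseteq> L2 M \<Longrightarrow> l2_subspace M (l2_span M B)"
  using l2_subspace_L2[of M] unfolding l2_subspace_def l2_span_def by blast

lemma l2_span_superset: "B \<subseteq> l2_span M B"
  by (auto simp: l2_span_def)

lemma l2_span_minimal: "l2_subspace M V \<Longrightarrow> B \<subseteq> V \<Longrightarrow> l2_span M B \<subseteq> V"
  by (auto simp: l2_span_def)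

lemma l2_span_mono: "A \<subseteq> B \<Longrightarrow> l2_span M A \<subseteq> l2_span M B"
  by (auto simp: l2_span_def)

section \<open>Completeness (Riesz-Fischer)\<close>

text \<open>Finiteness of \<open>M\<close> puts the constant 1 into \<open>l2_fun M\<close>, so
  Cauchy-Schwarz bounds L1 distances by L2 distances. The L1 theory then supplies the almost
  everywhere convergent subsequence.\<close>

lemma l2_complete:
  assumes "finite_measure M"
    and X: "\<And>i. X i \<in> L2 M"
    and Cauchy: "\<And>e. e > 0 \<Longrightarrow> \<exists>N. \<forall>i\<ge>N. \<forall>j\<ge>N. l2_dist M (X i) (X j) < e"
  obtains u where "u \<in> L2 M" "(\<lambda>i. l2_dist M u (X i)) \<longlonglongrightarrow> 0"
proof -
  interpret finite_measure M by fact
  define s where "s i = l2_rep (X i)" for i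
  have s: "s i \<in> l2_fun M" "X i = l2_cls M (s i)" for i
  proof -
    obtain f where f: "f \<in> l2_fun M" "X i = l2_cls M f" using X[of i] by (elim L2_cases)
    then show "s i \<in> l2_fun M" "X i = l2_cls M (s i)"
      using l2_rep_cls[OF f(1)] l2_cls_cong[of "l2_rep (X i)" f M] by (auto simp: s_def)
  qed
  have [measurable]: "s i \<in> borel_measurable M" for i
    using s(1)[of i] by (simp add: l2_fun_def)
  have s_diff: "(\<lambda>x. s i x - s j x) \<in> l2_fun M" for i j
    using s(1) by (intro l2_fun_diff)
  have one: "(\<lambda>_. 1) \<in> l2_fun M"
    by (simp add: l2_fun_def)
  have int_s: "integrable M (s i)" for i
    using l2_fun_mult_integrable[OF s(1) one] by simp
  define C where "C = l2_norm M (l2_cls M (\<lambda>_. 1))"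
  have L1_le: "(LINT x|M. cmod (s i x - s j x)) \<le> l2_dist M (X i) (X j) * C" for i j
  proof -
    \<comment> \<open>The inner product of \<open>h\<close> with 1 is the L1 distance, while the
      norm of \<open>h\<close> is the L2 distance.\<close>
    define h where "h = (\<lambda>x. complex_of_real (cmod (s i x - s j x)))"
    have h: "h \<in> l2_fun M"
      using s_diff[of i j] by (simp add: l2_fun_def h_def)
    have "(LINT x|M. cmod (s i x - s j x)) = cmod (l2_inner M (l2_cls M h) (l2_cls M (\<lambda>_. 1)))"
      using h one by (simp add: l2_inner_cls h_def)
    also have "\<dots> \<le> l2_norm M (l2_cls M h) * C"
      unfolding C_def using h one by (intro l2_Cauchy_Schwarz l2_cls_in_L2)
    also have "l2_norm M (l2_cls M h) = l2_dist M (X i) (X j)"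
      by (rule power2_eq_imp_eq) (use h s in \<open>simp_all add: l2_norm_cls l2_dist_cls h_def\<close>)
    finally show ?thesis .
  qed
  have L1_Cauchy: "\<exists>N. \<forall>i\<ge>N. \<forall>j\<ge>N. (LINT x|M. norm (s i x - s j x)) < e" if "e > 0" for e
  proof -
    have C: "0 \<le> C" by (simp add: C_def)
    \<comment> \<open>The denominator is \<open>C + 1\<close> because \<open>C\<close> is zero when
      \<open>M\<close> is the null measure.\<close>
    obtain N where N: "\<And>i j. i \<ge> N \<Longrightarrow> j \<ge> N \<Longrightarrow> l2_dist M (X i) (X j) < e / (C + 1)"
      using Cauchy[of "e / (C + 1)"] \<open>e > 0\<close> C by (meson divide_pos_pos add_nonneg_pos zero_less_one)
    have "l2_dist M (X i) (X j) * C < e" if "i \<ge> N" "j \<ge> N" for i j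
    proof -
      have "l2_dist M (X i) (X j) * C \<le> l2_dist M (X i) (X j) * (C + 1)"
        by (intro mult_left_mono) auto
      also have "\<dots> < e"
        using N[OF that] C by (simp add: pos_less_divide_eq)
      finally show ?thesis .
    qed
    then show ?thesis
      using L1_le by (meson le_less_trans)
  qed
  obtain r where r: "strict_mono r" "AE x in M. Cauchy (\<lambda>i. s (r i) x)"
    using cauchy_L1_AE_cauchy_subseq[OF int_s L1_Cauchy] by blast
  \<comment> \<open>Where the subsequence diverges, \<open>lim\<close> is unspecified; this concerns
    only a null set, and \<open>f\<close> is measurable all the same.\<close>
  define f where "f x = lim (\<lambda>i. s (r i) x)" for x
  have f_lim: "AE x in M. (\<lambda>i. s (r i) x) \<longlonglongrightarrow> f x"
    using r(2) by (auto simp: f_def Cauchy_convergent_iff convergent_LIMSEQ_iff)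
  have [measurable]: "f \<in> borel_measurable M"
    unfolding f_def by measurable
  \<comment> \<open>The nonnegative integral makes sense before \<open>f\<close> is known to be
    square-integrable. Its finiteness then gives \<open>diff\<close>, and its size gives the
    convergence.\<close>
  have Fatou: "(\<integral>\<^sup>+x. ennreal ((cmod (f x - s j x))\<^sup>2) \<partial>M) \<le> ennreal (e\<^sup>2)"
    if "e > 0" and N: "\<forall>i\<ge>N. \<forall>j\<ge>N. l2_dist M (X i) (X j) < e" and "j \<ge> N" for e N j
  proof -
    have "(\<integral>\<^sup>+x. ennreal ((cmod (f x - s j x))\<^sup>2) \<partial>M)
        = (\<integral>\<^sup>+x. liminf (\<lambda>i. ennreal ((cmod (s (r i) x - s j x))\<^sup>2)) \<partial>M)"
    proof (rule nn_integral_cong_AE, use f_lim in eventually_elim)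
      fix x assume "(\<lambda>i. s (r i) x) \<longlonglongrightarrow> f x"
      then have "(\<lambda>i. ennreal ((cmod (s (r i) x - s j x))\<^sup>2)) \<longlonglongrightarrow> ennreal ((cmod (f x - s j x))\<^sup>2)"
        by (intro tendsto_ennrealI tendsto_intros)
      then show "ennreal ((cmod (f x - s j x))\<^sup>2) = liminf (\<lambda>i. ennreal ((cmod (s (r i) x - s j x))\<^sup>2))"
        using lim_imp_Liminf[OF sequentially_bot] by metis
    qed
    also have "\<dots> \<le> liminf (\<lambda>i. \<integral>\<^sup>+x. ennreal ((cmod (s (r i) x - s j x))\<^sup>2) \<partial>M)"
      by (rule nn_integral_liminf) measurable
    also have "\<dots> \<le> ennreal (e\<^sup>2)"
    proof (rule Liminf_le)
      show "\<forall>\<^sub>F i in sequentially. (\<integral>\<^sup>+x. ennreal ((cmod (s (r i) x - s j x))\<^sup>2) \<partial>M) \<le> ennreal (e\<^sup>2)"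
      proof (rule eventually_sequentiallyI[of N])
        fix i assume "N \<le> i"
        then have "N \<le> r i" using strict_mono_imp_increasing[OF r(1), of i] by linarith
        then have "l2_dist M (X (r i)) (X j) < e" using N \<open>j \<ge> N\<close> by blast
        then have "(l2_dist M (X (r i)) (X j))\<^sup>2 \<le> e\<^sup>2" by (intro power_mono) auto
        then have "(LINT x|M. (cmod (s (r i) x - s j x))\<^sup>2) \<le> e\<^sup>2"
          using s by (simp add: l2_dist_cls)
        then show "(\<integral>\<^sup>+x. ennreal ((cmod (s (r i) x - s j x))\<^sup>2) \<partial>M) \<le> ennreal (e\<^sup>2)"
          using s_diff[of "r i" j] by (subst nn_integral_eq_integral) (auto simp: l2_fun_def)
      qed
    qed simp
    finally show ?thesis .
  qed
  have diff: "(\<lambda>x. f x - s j x) \<in> l2_fun M"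
    if "e > 0" and N: "\<forall>i\<ge>N. \<forall>j\<ge>N. l2_dist M (X i) (X j) < e" and "j \<ge> N" for e N j
    using Fatou[OF that] by (auto simp: l2_fun_def integrable_iff_bounded intro: order.strict_trans1)
  obtain N1 where N1: "\<forall>i\<ge>N1. \<forall>j\<ge>N1. l2_dist M (X i) (X j) < 1"
    using Cauchy[of 1] by auto
  \<comment> \<open>Writing f = (f - s N1) + s N1 makes \<open>f\<close> a sum of two
    square-integrable functions.\<close>
  have f: "f \<in> l2_fun M"
    using l2_fun_add[OF diff[OF _ N1, of N1] s(1)[of N1]] by simp
  have "(\<lambda>i. l2_dist M (l2_cls M f) (X i)) \<longlonglongrightarrow> 0"
  proof (rule LIMSEQ_I)
    fix e :: real assume "e > 0"
    \<comment> \<open>Fatou yields only a weak inequality, so e/2 is used to end strictly below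
      e.\<close>
    then obtain N where N: "\<forall>i\<ge>N. \<forall>j\<ge>N. l2_dist M (X i) (X j) < e / 2"
      using Cauchy[of "e / 2"] by auto
    have "l2_dist M (l2_cls M f) (X j) < e" if "j \<ge> N" for j
    proof -
      have "ennreal (LINT x|M. (cmod (f x - s j x))\<^sup>2) \<le> ennreal ((e / 2)\<^sup>2)"
        using Fatou[OF _ N that] diff[OF _ N that] \<open>e > 0\<close>
        by (subst nn_integral_eq_integral[symmetric]) (auto simp: l2_fun_def)
      then have "(l2_dist M (l2_cls M f) (X j))\<^sup>2 \<le> (e / 2)\<^sup>2"
        using f s by (simp add: l2_dist_cls)
      then have "l2_dist M (l2_cls M f) (X j) \<le> e / 2"
        by (rule power2_le_imp_le) (use \<open>e > 0\<close> in simp)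
      then show ?thesis using \<open>e > 0\<close> by simp
    qed
    then show "\<exists>N. \<forall>j\<ge>N. norm (l2_dist M (l2_cls M f) (X j) - 0) < e" by auto
  qed
  with f show thesis
    using that l2_cls_in_L2 by blast
qed


section \<open>The line spanned by a unit vector\<close>

lemma l2_span_singleton:
  assumes "e \<in> L2 M"
  shows "l2_span M {e} = range (\<lambda>c. l2_scale M c e)"
proof -
  obtain f where f: "f \<in> l2_fun M" "e = l2_cls M f"
    using assms by (elim L2_cases)
  have "l2_zero M = l2_scale M 0 e"
    by (simp add: f l2_scale_cls l2_zero_def)
  moreover have "l2_add M (l2_scale M c e) (l2_scale M d e) = l2_scale M (c + d) e" for c d
    by (simp add: f l2_scale_cls l2_add_cls l2_fun_scale distrib_right)
  moreover have "l2_scale M c (l2_scale M d e) = l2_scale M (c * d) e" for c d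
    by (simp add: f l2_scale_cls l2_fun_scale mult.assoc)
  ultimately have "l2_subspace M (range (\<lambda>c. l2_scale M c e))"
    using assms by (auto simp: l2_subspace_def)
  moreover have "e \<in> range (\<lambda>c. l2_scale M c e)"
    by (rule image_eqI[of _ _ 1]) (simp_all add: f l2_scale_cls)
  ultimately have "l2_span M {e} \<subseteq> range (\<lambda>c. l2_scale M c e)"
    by (simp add: l2_span_minimal)
  moreover have "l2_scale M c e \<in> l2_span M {e}" for c
    unfolding l2_span_def l2_subspace_def by blast
  ultimately show ?thesis by blast
qed

text \<open>
  The residual \<open>u - \<langle>u, e\<rangle>e\<close> is orthogonal to \<open>e\<close>, so its norm is at most the distance
  from \<open>u\<close> to any multiple of \<open>e\<close>.
\<close>

lemma l2_closure_span_singleton: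
  assumes e: "e \<in> L2 M" and "l2_inner M e e = 1"
  shows "l2_closure M (l2_span M {e}) = l2_span M {e}"
proof
  show "l2_closure M (l2_span M {e}) \<subseteq> l2_span M {e}"
  proof
    fix u assume u: "u \<in> l2_closure M (l2_span M {e})"
    then have uL: "u \<in> L2 M" by (simp add: l2_closure_def)
    define p where "p = l2_scale M (l2_inner M u e) e"
    define w where "w = l2_add M u (l2_scale M (-1) p)"
    have [simp]: "p \<in> L2 M" "w \<in> L2 M"
      using uL e by (simp_all add: p_def w_def)
    have "l2_inner M w e = 0"
      using uL e assms(2) by (simp add: w_def p_def l2_inner_simps)
    then have we: "l2_inner M w (l2_scale M c e) = 0" for c
      using e by (simp add: l2_inner_simps)
    have le: "l2_norm M w \<le> l2_dist M u (l2_scale M d e)" for d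
    proof -
      \<comment> \<open>Since \<open>w\<close> is orthogonal to all multiples of \<open>e\<close>,
        <w, w> = <w, u> = <w, u - d e>. Cauchy-Schwarz then leaves a common factor |w| to
        cancel.\<close>
      have "of_real ((l2_norm M w)\<^sup>2) = l2_inner M w u"
        using uL we[of "l2_inner M u e"] unfolding l2_inner_self[symmetric]
        by (subst (2) w_def) (simp add: l2_inner_simps flip: p_def)
      also have "\<dots> = l2_inner M w (l2_add M u (l2_scale M (-1) (l2_scale M d e)))"
        using uL e we by (simp add: l2_inner_add_right l2_inner_scale_right[of "l2_scale M d e"])
      finally have "(l2_norm M w)\<^sup>2 = cmod (l2_inner M w (l2_add M u (l2_scale M (-1) (l2_scale M d e))))"
        by (metis norm_of_real abs_of_nonneg zero_le_power2)
      also have "\<dots> \<le> l2_norm M w * l2_dist M u (l2_scale M d e)"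
        unfolding l2_dist_def using uL e by (intro l2_Cauchy_Schwarz) auto
      finally show ?thesis
        by (cases "l2_norm M w = 0") (auto simp: power2_eq_square less_le)
    qed
    have "l2_norm M w < \<epsilon>" if "\<epsilon> > 0" for \<epsilon>
    proof -
      have "\<exists>v\<in>l2_span M {e}. l2_dist M u v < \<epsilon>"
        using u that by (simp add: l2_closure_def)
      then obtain d where "l2_dist M u (l2_scale M d e) < \<epsilon>"
        unfolding l2_span_singleton[OF e] by blast
      then show ?thesis
        using le[of d] by linarith
    qed
    \<comment> \<open>A positive norm would be smaller than itself.\<close>
    from this[of "l2_norm M w"] have "l2_norm M w = 0"
      using l2_norm_nonneg[of M w] by argo
    then have "l2_dist M u p = 0"
      by (simp add: l2_dist_def w_def)
    then have "u = p"
      using uL by (intro l2_dist_eq_0D) auto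
    then show "u \<in> l2_span M {e}"
      by (simp add: p_def l2_span_singleton[OF e])
  qed
  show "l2_span M {e} \<subseteq> l2_closure M (l2_span M {e})"
    using e by (intro l2_subset_closure) (auto simp: l2_span_singleton)
qed

section \<open>Isometries: inner products, closed ranges, orthogonality of ranges\<close>

lemma l2_isometryD:
  assumes "l2_isometry M S"
  shows "u \<in> L2 M \<Longrightarrow> S u \<in> L2 M"
    and "u \<in> L2 M \<Longrightarrow> v \<in> L2 M \<Longrightarrow> S (l2_add M u v) = l2_add M (S u) (S v)"
    and "u \<in> L2 M \<Longrightarrow> S (l2_scale M c u) = l2_scale M c (S u)"
    and "u \<in> L2 M \<Longrightarrow> l2_norm M (S u) = l2_norm M u"
  using assms unfolding l2_isometry_def by blast+

lemma l2_isometry_dist: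
  assumes "l2_isometry M S" "u \<in> L2 M" "v \<in> L2 M"
  shows "l2_dist M (S u) (S v) = l2_dist M u v"
  using l2_isometryD(4)[OF assms(1), of "l2_add M u (l2_scale M (-1) v)"] assms
  by (simp add: l2_dist_def l2_isometryD[OF assms(1)])

text \<open>Polarization: the norm of a sum determines the real part. Replacing \<open>v\<close> by
  \<i> v gives the imaginary part, because <u, \<i> v> = -\<i> <u, v> has real part Im <u,
  v>.\<close>

lemma l2_isometry_inner:
  assumes S: "l2_isometry M S" and u: "u \<in> L2 M" and v: "v \<in> L2 M"
  shows "l2_inner M (S u) (S v) = l2_inner M u v"
proof -
  have Re: "Re (l2_inner M (S u) (S w)) = Re (l2_inner M u w)" if w: "w \<in> L2 M" for w
    using l2_isometryD(4)[OF S, of "l2_add M u w"] l2_norm_add_squared[OF u w]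
      l2_norm_add_squared[OF l2_isometryD(1)[OF S u] l2_isometryD(1)[OF S w]] u w
    by (simp add: l2_isometryD[OF S])
  have "Im (l2_inner M (S u) (S v)) = Im (l2_inner M u v)"
    using Re[of "l2_scale M \<i> v"] u v by (simp add: l2_isometryD[OF S] l2_inner_simps)
  with Re[OF v] show ?thesis
    by (simp add: complex_eq_iff)
qed

lemma l2_isometry_comp: "l2_isometry M S \<Longrightarrow> l2_isometry M T \<Longrightarrow> l2_isometry M (S \<circ> T)"
  by (simp add: l2_isometry_def)

lemma l2_isometry_funpow: "l2_isometry M S \<Longrightarrow> l2_isometry M (S ^^ k)"
proof (induction k)
  case 0
  show ?case by (simp add: l2_isometry_def)
next
  case (Suc k)
  then show ?case unfolding funpow.simps by (intro l2_isometry_comp)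
qed

lemma l2_scale_0: "u \<in> L2 M \<Longrightarrow> l2_scale M 0 u = l2_zero M"
  by (elim L2_cases) (simp add: l2_scale_cls l2_zero_def)

lemma l2_isometry_zero:
  assumes "l2_isometry M S"
  shows "S (l2_zero M) = l2_zero M"
  using l2_isometryD(3)[OF assms l2_zero_in_L2, of 0]
  unfolding l2_scale_0[OF l2_zero_in_L2] l2_scale_0[OF l2_isometryD(1)[OF assms l2_zero_in_L2]] .

lemma l2_inner_zero_left: "x \<in> L2 M \<Longrightarrow> l2_inner M (l2_zero M) x = 0"
  using l2_inner_scale_left[OF l2_zero_in_L2, of x M 0] by (simp add: l2_scale_0[OF l2_zero_in_L2])

lemma l2_subspace_isometry_range:
  assumes S: "l2_isometry M S"
  shows "l2_subspace M (S ` L2 M)"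
  unfolding l2_subspace_def
proof (intro conjI ballI allI)
  show "l2_zero M \<in> S ` L2 M"
    using l2_isometry_zero[OF S] by (intro image_eqI[of _ _ "l2_zero M"]) simp_all
next
  fix u v assume "u \<in> S ` L2 M" "v \<in> S ` L2 M"
  then show "l2_add M u v \<in> S ` L2 M"
    by (auto simp flip: l2_isometryD(2)[OF S])
next
  fix c u assume "u \<in> S ` L2 M"
  then show "l2_scale M c u \<in> S ` L2 M"
    by (auto simp flip: l2_isometryD(3)[OF S])
qed (auto simp: l2_isometryD[OF S])

text \<open>Preimages of a sequence approaching \<open>u\<close> are Cauchy because \<open>S\<close>
  preserves distances. Completeness gives them a limit \<open>v\<close>, and continuity of
  \<open>S\<close> forces S v = u.\<close>

lemma l2_closure_isometry_range:
  assumes M: "finite_measure M" and S: "l2_isometry M S"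
  shows "l2_closure M (S ` L2 M) = S ` L2 M"
proof
  show "l2_closure M (S ` L2 M) \<subseteq> S ` L2 M"
  proof
    fix u assume u: "u \<in> l2_closure M (S ` L2 M)"
    then have uL: "u \<in> L2 M" by (simp add: l2_closure_def)
    have "\<exists>v\<in>L2 M. l2_dist M u (S v) < 1 / real (Suc i)" for i
      using u by (auto simp: l2_closure_def)
    then obtain X where X: "\<And>i. X i \<in> L2 M" "\<And>i. l2_dist M u (S (X i)) < 1 / real (Suc i)"
      by metis
    have SX: "S (X i) \<in> L2 M" for i
      using X by (simp add: l2_isometryD[OF S])
    have lim: "(\<lambda>i. l2_dist M u (S (X i))) \<longlonglongrightarrow> 0"
      by (rule tendsto_sandwich[OF _ _ tendsto_const LIMSEQ_inverse_real_of_nat])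
        (use X(2) in \<open>auto simp: inverse_eq_divide intro!: always_eventually less_imp_le\<close>)
    have "\<exists>N. \<forall>i\<ge>N. \<forall>j\<ge>N. l2_dist M (X i) (X j) < e" if "e > 0" for e
    proof -
      obtain N where N: "\<And>i. i \<ge> N \<Longrightarrow> l2_dist M u (S (X i)) < e / 2"
        using LIMSEQ_D[OF lim, of "e / 2"] \<open>e > 0\<close> by auto
      have "l2_dist M (X i) (X j) < e" if "i \<ge> N" "j \<ge> N" for i j
        using l2_dist_triangle[OF SX[of i] uL SX[of j]] N[OF that(1)] N[OF that(2)]
        by (simp add: l2_isometry_dist[OF S] X l2_dist_commute[OF SX uL])
      then show ?thesis by blast
    qed
    then obtain v where v: "v \<in> L2 M" "(\<lambda>i. l2_dist M v (X i)) \<longlonglongrightarrow> 0"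
      using l2_complete[OF M, of X] X(1) by blast
    have Sv: "S v \<in> L2 M" using v by (simp add: l2_isometryD[OF S])
    have "(\<lambda>i. l2_dist M u (S (X i)) + l2_dist M v (X i)) \<longlonglongrightarrow> 0 + 0"
      by (intro tendsto_add lim v)
    moreover have "l2_dist M u (S v) \<le> l2_dist M u (S (X i)) + l2_dist M v (X i)" for i
      using l2_dist_triangle[OF uL SX[of i] Sv] l2_dist_commute[OF SX[of i] Sv]
      by (simp add: l2_isometry_dist[OF S] X v)
    ultimately have "l2_dist M u (S v) \<le> 0 + 0"
      by (intro LIMSEQ_le_const) auto
    then have "u = S v"
      using uL Sv l2_dist_nonneg[of M u "S v"] by (intro l2_dist_eq_0D) auto
    with v show "u \<in> S ` L2 M" by blast
  qed
  show "S ` L2 M \<subseteq> l2_closure M (S ` L2 M)"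
    by (intro l2_subset_closure) (auto simp: l2_isometryD[OF S])
qed

text \<open>The vectors whose image is orthogonal to \<open>x\<close> form a subspace containing
  \<open>B\<close>, hence its span; Cauchy-Schwarz carries the orthogonality over to the
  closure.\<close>

lemma l2_isometry_orthogonal_total:
  assumes S: "l2_isometry M S" and x: "x \<in> L2 M"
    and B: "B \<subseteq> L2 M" "l2_closure M (l2_span M B) = L2 M"
    and orth: "\<And>b. b \<in> B \<Longrightarrow> l2_inner M (S b) x = 0"
    and u: "u \<in> L2 M"
  shows "l2_inner M (S u) x = 0"
proof -
  define V where "V = {u \<in> L2 M. l2_inner M (S u) x = 0}"
  have "l2_subspace M V"
    unfolding l2_subspace_def
  proof (intro conjI ballI allI)
    show "l2_zero M \<in> V"
      by (simp add: V_def l2_isometry_zero[OF S] l2_inner_zero_left[OF x])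
  next
    fix u v assume "u \<in> V" "v \<in> V"
    then show "l2_add M u v \<in> V"
      using l2_inner_add_left[OF l2_isometryD(1)[OF S] l2_isometryD(1)[OF S] x, of u v]
      by (simp add: V_def l2_isometryD(2)[OF S])
  next
    fix c u assume "u \<in> V"
    then show "l2_scale M c u \<in> V"
      using l2_inner_scale_left[OF l2_isometryD(1)[OF S] x, of u c]
      by (simp add: V_def l2_isometryD(3)[OF S])
  qed (simp add: V_def)
  moreover have "B \<subseteq> V"
    using B(1) orth unfolding V_def by blast
  ultimately have span: "l2_span M B \<subseteq> V"
    by (rule l2_span_minimal)
  have "cmod (l2_inner M (S u) x) \<le> e" if "e > 0" for e
  proof -
    \<comment> \<open>Adding 1 to the norm covers the case that \<open>x\<close> has norm
      zero.\<close>
    have pos: "e / (l2_norm M x + 1) > 0"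
      using \<open>e > 0\<close> by (intro divide_pos_pos add_nonneg_pos) auto
    have "u \<in> l2_closure M (l2_span M B)" using u B by simp
    then have "\<exists>v\<in>l2_span M B. l2_dist M u v < e / (l2_norm M x + 1)"
      using pos by (simp only: l2_closure_def mem_Collect_eq)
    then obtain v where v: "v \<in> L2 M" "l2_inner M (S v) x = 0" "l2_dist M u v < e / (l2_norm M x + 1)"
      using span unfolding V_def by blast
    have "l2_inner M (S u) x = l2_inner M (l2_add M (S u) (l2_scale M (-1) (S v))) x"
      using u v x by (simp add: l2_inner_simps l2_isometryD[OF S])
    then have "cmod (l2_inner M (S u) x) \<le> l2_dist M (S u) (S v) * l2_norm M x"
      using l2_Cauchy_Schwarz[of "l2_add M (S u) (l2_scale M (-1) (S v))" M x] u v x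
      by (simp add: l2_dist_def l2_isometryD[OF S])
    also have "\<dots> \<le> l2_dist M u v * (l2_norm M x + 1)"
      using u v by (simp add: l2_isometry_dist[OF S] mult_left_mono)
    also have "\<dots> \<le> e"
      using v(3) l2_norm_nonneg[of M x] by (simp add: pos_less_divide_eq)
    finally show ?thesis .
  qed
  then show ?thesis
    using field_le_epsilon[of "cmod (l2_inner M (S u) x)" 0] by simp
qed

text \<open>Two passages to the closure, one in each argument: first from \<open>c\<close> to
  \<open>v\<close> with \<open>b\<close> fixed, then from \<open>b\<close> to
  \<open>u\<close>.\<close>

lemma l2_isometry_ranges_orthogonal:
  assumes S: "l2_isometry M S" and T: "l2_isometry M T"
    and B: "B \<subseteq> L2 M" "l2_closure M (l2_span M B) = L2 M"
    and orth: "\<And>b c. b \<in> B \<Longrightarrow> c \<in> B \<Longrightarrow> l2_inner M (S b) (T c) = 0"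
    and u: "u \<in> L2 M" and v: "v \<in> L2 M"
  shows "l2_inner M (S u) (T v) = 0"
proof (rule l2_isometry_orthogonal_total[OF S _ B _ u])
  show "T v \<in> L2 M" using T v by (simp add: l2_isometryD)
  fix b assume b: "b \<in> B"
  have "l2_inner M (T v) (S b) = 0"
  proof (rule l2_isometry_orthogonal_total[OF T _ B _ v])
    show "S b \<in> L2 M" using S b B by (auto simp: l2_isometryD)
    fix c assume "c \<in> B"
    then show "l2_inner M (T c) (S b) = 0"
      using orth[OF b] l2_inner_commute[of M "T c" "S b"] by simp
  qed
  then show "l2_inner M (S b) (T v) = 0"
    using l2_inner_commute[of M "S b" "T v"] by simp
qed

section \<open>Digit expansions in the canonical index set\<close>

lemma canonical_index_setI:
  assumes "\<And>i. i \<le> m \<Longrightarrow> a i \<in> {0, real n / 2}"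
  shows "(\<Sum>i=0..m. a i * (2 * real n) ^ i) \<in> canonical_index_set n"
  unfolding canonical_index_set_def mem_Collect_eq
  by (rule exI[of _ m], rule exI[of _ a]) (use assms in auto)

lemma canonical_index_set_0: "0 \<in> canonical_index_set n"
  using canonical_index_setI[of 0 "\<lambda>_. 0" n] by simp

text \<open>Multiplication by 2n shifts the digits up one place, and \<open>a\<close> becomes the
  new lowest digit.\<close>

lemma canonical_index_set_digit:
  assumes "a \<in> {0, real n / 2}" "\<gamma> \<in> canonical_index_set n"
  shows "a + 2 * real n * \<gamma> \<in> canonical_index_set n"
proof -
  obtain m b where b: "\<gamma> = (\<Sum>i=0..m. b i * (2 * real n) ^ i)" "\<forall>i\<le>m. b i \<in> {0, real n / 2}"
    using assms(2) by (auto simp: canonical_index_set_def)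
  have "a + 2 * real n * \<gamma> = (\<Sum>i=0..Suc m. (case i of 0 \<Rightarrow> a | Suc i \<Rightarrow> b i) * (2 * real n) ^ i)"
    unfolding b(1) by (subst sum.atLeast0_atMost_Suc_shift) (simp add: sum_distrib_left ac_simps)
  also have "\<dots> \<in> canonical_index_set n"
    using assms(1) b(2) by (intro canonical_index_setI) (auto split: nat.split)
  finally show ?thesis .
qed

text \<open>Induction on the number of digits, peeling off the lowest: a zero digit passes a factor
  2n on and raises \<open>k\<close> by one, while a digit n/2 stops with k = 0. The exponent
  \<open>k\<close> is the index of the summand W_k that contains the exponential.\<close>

lemma canonical_index_set_cases:
  assumes "\<gamma> \<in> canonical_index_set n"
  obtains "\<gamma> = 0"
  | k \<delta> where "\<delta> \<in> canonical_index_set n" "\<gamma> = (2 * real n) ^ k * (real n / 2 + 2 * real n * \<delta>)"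
proof -
  obtain m b where "\<gamma> = (\<Sum>i=0..m. b i * (2 * real n) ^ i)" "\<forall>i\<le>m. b i \<in> {0, real n / 2}"
    using assms by (auto simp: canonical_index_set_def)
  then have "\<gamma> = 0 \<or> (\<exists>k. \<exists>\<delta>\<in>canonical_index_set n. \<gamma> = (2 * real n) ^ k * (real n / 2 + 2 * real n * \<delta>))"
  proof (induction m arbitrary: b \<gamma>)
    case 0
    \<comment> \<open>A lone digit n/2 is the case k = 0, \<delta> = 0.\<close>
    then show ?case
      using canonical_index_set_0[of n] by (auto intro!: exI[of _ 0] bexI[of _ 0])
  next
    case (Suc m)
    define \<delta> where "\<delta> = (\<Sum>i=0..m. b (Suc i) * (2 * real n) ^ i)"
    have \<delta>: "\<delta> \<in> canonical_index_set n"
      unfolding \<delta>_def using Suc.prems(2) by (intro canonical_index_setI) (simp del: insert_iff)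
    have \<gamma>: "\<gamma> = b 0 + 2 * real n * \<delta>"
      unfolding Suc.prems(1) \<delta>_def
      by (subst sum.atLeast0_atMost_Suc_shift) (simp add: sum_distrib_left ac_simps)
    consider "b 0 = 0" | "b 0 = real n / 2"
      using Suc.prems(2) by auto
    then show ?case
    proof cases
      case 1
      have "\<delta> = 0 \<or> (\<exists>k. \<exists>\<eta>\<in>canonical_index_set n. \<delta> = (2 * real n) ^ k * (real n / 2 + 2 * real n * \<eta>))"
        using Suc.IH[of \<delta> "\<lambda>i. b (Suc i)"] Suc.prems(2) by (simp add: \<delta>_def)
      then show ?thesis
      proof
        assume "\<exists>k. \<exists>\<eta>\<in>canonical_index_set n. \<delta> = (2 * real n) ^ k * (real n / 2 + 2 * real n * \<eta>)"
        then obtain k \<eta> where "\<eta> \<in> canonical_index_set n"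
            "\<delta> = (2 * real n) ^ k * (real n / 2 + 2 * real n * \<eta>)"
          by blast
        then show ?thesis
          using 1 \<gamma> by (intro disjI2 exI[of _ "Suc k"] bexI[of _ \<eta>]) (simp_all add: mult.assoc)
      qed (use 1 \<gamma> in simp)
    next
      case 2
      then show ?thesis
        using \<gamma> \<delta> by (intro disjI2 exI[of _ 0] bexI[of _ \<delta>]) auto
    qed
  qed
  then show thesis using that by blast
qed

text \<open>As n/2 need not be an integer, it serves as the unit: the digits become 0 or 1, and
  parity arguments apply to the resulting natural number.\<close>

lemma canonical_index_set_multiple:
  assumes "\<gamma> \<in> canonical_index_set n"
  obtains m :: nat where "\<gamma> = real n / 2 * real m"
proof -
  obtain m b where b: "\<gamma> = (\<Sum>i=0..m. b i * (2 * real n) ^ i)" "\<forall>i\<le>m. b i \<in> {0, real n / 2}"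
    using assms by (auto simp: canonical_index_set_def)
  have "b i * (2 * real n) ^ i = real n / 2 * real ((if b i = 0 then 0 else 1) * (2 * n) ^ i)" if "i \<le> m" for i
    using b(2) that by auto
  then have "\<gamma> = (\<Sum>i=0..m. real n / 2 * real ((if b i = 0 then 0 else 1) * (2 * n) ^ i))"
    unfolding b(1) by (intro sum.cong) auto
  also have "\<dots> = real n / 2 * real (\<Sum>i=0..m. (if b i = 0 then 0 else 1) * (2 * n) ^ i)"
    by (simp only: of_nat_sum sum_distrib_left)
  finally show thesis using that by blast
qed

text \<open>In units of \<open>n/2\<close> the two sides are \<open>1\<close> and \<open>0\<close> modulo \<open>2n\<close>.\<close>

lemma canonical_index_set_disjoint:
  assumes "n \<ge> 1" "\<gamma> \<in> canonical_index_set n" "\<delta> \<in> canonical_index_set n"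
  shows "real n / 2 + 2 * real n * \<gamma> \<noteq> 2 * real n * \<delta>"
proof
  assume eq: "real n / 2 + 2 * real n * \<gamma> = 2 * real n * \<delta>"
  obtain k l :: nat where "\<gamma> = real n / 2 * real k" "\<delta> = real n / 2 * real l"
    using assms(2,3) by (elim canonical_index_set_multiple)
  with eq have "real n / 2 * real (1 + 2 * (n * k)) = real n / 2 * real (2 * (n * l))"
    by (simp add: algebra_simps)
  then have "1 + 2 * (n * k) = 2 * (n * l)"
    using assms(1) by (simp only: mult_cancel_left of_nat_eq_iff) auto
  \<comment> \<open>The grouping \<open>2 * (n * k)\<close> exposes the parity: the left side is
    odd, the right side even.\<close>
  then show False by presburger
qed

section \<open>Closedness, orthogonality and totality of the summands\<close>

theorem proposition3p5:
  fixes n :: nat and \<mu> :: "real measure"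
    and S0 S1 :: "(real \<Rightarrow> complex) set \<Rightarrow> (real \<Rightarrow> complex) set"
  assumes "n \<ge> 1"
    and "bernoulli_convolution (1 / (2 * real n)) \<mu>"
    and "l2_orthonormal_basis \<mu> (canonical_index_set n) (l2_exp \<mu>)"
    and "l2_isometry \<mu> S0"
    and "\<And>\<gamma>. \<gamma> \<in> canonical_index_set n \<Longrightarrow> S0 (l2_exp \<mu> \<gamma>) = l2_exp \<mu> (2 * real n * \<gamma>)"
    and "l2_isometry \<mu> S1"
    and "\<And>\<gamma>. \<gamma> \<in> canonical_index_set n \<Longrightarrow>
           S1 (l2_exp \<mu> \<gamma>) = l2_exp \<mu> (real n / 2 + 2 * real n * \<gamma>)"
  shows "l2_orthogonal_direct_sum \<mu> (L2 \<mu>)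
           (\<lambda>j. case j of 0 \<Rightarrow> l2_span \<mu> {l2_exp \<mu> 0}
                        | Suc k \<Rightarrow> ((S0 ^^ k) \<circ> S1) ` L2 \<mu>)"
proof -
  let ?\<Gamma> = "canonical_index_set n"
  let ?e = "l2_exp \<mu>"
  \<comment> \<open>The index is shifted by one: \<open>V 0\<close> is the line through e_0, and
    \<open>V (Suc k)\<close> is W_k.\<close>
  define V where "V j = (case j of 0 \<Rightarrow> l2_span \<mu> {?e 0} | Suc k \<Rightarrow> ((S0 ^^ k) \<circ> S1) ` L2 \<mu>)" for j
  note S0 = assms(4) and S0e = assms(5) and S1 = assms(6) and S1e = assms(7)
  have M: "finite_measure \<mu>"
    using assms(2) by (simp add: bernoulli_convolution_def prob_space.finite_measure)
  have eL: "?e \<gamma> \<in> L2 \<mu>" if "\<gamma> \<in> ?\<Gamma>" for \<gamma>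
    using assms(3) that by (simp add: l2_orthonormal_basis_def)
  have ortho: "l2_inner \<mu> (?e \<gamma>) (?e \<delta>) = (if \<gamma> = \<delta> then 1 else 0)"
    if "\<gamma> \<in> ?\<Gamma>" "\<delta> \<in> ?\<Gamma>" for \<gamma> \<delta>
    using assms(3) that by (simp add: l2_orthonormal_basis_def)
  have total: "l2_closure \<mu> (l2_span \<mu> (?e ` ?\<Gamma>)) = L2 \<mu>"
    using assms(3) by (simp add: l2_orthonormal_basis_def)
  note zero = canonical_index_set_0[of n]
  have iso: "l2_isometry \<mu> ((S0 ^^ k) \<circ> S1)" for k
    by (intro l2_isometry_comp l2_isometry_funpow S0 S1)
  have V_closed: "l2_subspace \<mu> (V j) \<and> l2_closure \<mu> (V j) = V j" for j
    using eL[OF zero] ortho[OF zero zero]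
    by (auto simp: V_def l2_subspace_span l2_closure_span_singleton l2_subspace_isometry_range[OF iso]
        l2_closure_isometry_range[OF M iso] simp del: comp_apply split: nat.split)
  have V_L2: "V j \<subseteq> L2 \<mu>" for j
    using V_closed[of j] by (simp add: l2_subspace_def)
  \<comment> \<open>Only exponentials need checking. There the two frequencies have lowest digits
    n/2 and 0, so they are distinct elements of the index set.\<close>
  have S1_S0: "l2_inner \<mu> (S1 u) (S0 v) = 0" if "u \<in> L2 \<mu>" "v \<in> L2 \<mu>" for u v
  proof (rule l2_isometry_ranges_orthogonal[OF S1 S0 _ total _ that])
    show "?e ` ?\<Gamma> \<subseteq> L2 \<mu>" using eL by auto
    fix b c assume "b \<in> ?e ` ?\<Gamma>" "c \<in> ?e ` ?\<Gamma>"
    then obtain \<gamma> \<delta> where "b = ?e \<gamma>" "\<gamma> \<in> ?\<Gamma>" "c = ?e \<delta>" "\<delta> \<in> ?\<Gamma>" by auto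
    then show "l2_inner \<mu> (S1 b) (S0 c) = 0"
      using canonical_index_set_disjoint[OF assms(1)] canonical_index_set_digit[of 0 n \<delta>]
        canonical_index_set_digit[of "real n / 2" n \<gamma>]
      by (simp add: S0e S1e ortho)
  qed
  \<comment> \<open>Membership of the frequency is carried along because the action of
    \<open>S0\<close> is given only on frequencies in the index set.\<close>
  have S0_pow_e: "(S0 ^^ k) (?e \<gamma>) = ?e ((2 * real n) ^ k * \<gamma>) \<and> (2 * real n) ^ k * \<gamma> \<in> ?\<Gamma>"
    if "\<gamma> \<in> ?\<Gamma>" for k \<gamma>
    using that canonical_index_set_digit[of 0 n] by (induction k) (auto simp: S0e mult.assoc)
  \<comment> \<open>Common core of the next two facts: cancelling \<open>S0 ^^ k\<close> on both
    sides leaves an inner product of an \<open>S1\<close> image with an \<open>S0\<close>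
    image.\<close>
  have V_Suc: "l2_inner \<mu> u v = 0" if u: "u \<in> V (Suc k)" and v: "v = (S0 ^^ Suc k) w" "w \<in> L2 \<mu>" for k u v w
  proof -
    obtain x where x: "x \<in> L2 \<mu>" "u = (S0 ^^ k) (S1 x)"
      using u by (auto simp: V_def)
    have "v = (S0 ^^ k) (S0 w)" by (simp add: v funpow_swap1)
    then show ?thesis
      using x v S1_S0
      by (simp add: l2_isometry_inner[OF l2_isometry_funpow[OF S0]] l2_isometryD(1)[OF S0]
          l2_isometryD(1)[OF S1])
  qed
  have V_0: "l2_inner \<mu> u v = 0" if u: "u \<in> V (Suc k)" and v: "v \<in> V 0" for k u v
  proof -
    obtain c where "v = l2_scale \<mu> c (?e 0)"
      using v eL[OF zero] by (auto simp: V_def l2_span_singleton)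
    \<comment> \<open>Since \<open>S0\<close> fixes e_0, the vector e_0 is its own image under
      \<open>S0 ^^ Suc k\<close>.\<close>
    moreover have "l2_inner \<mu> u (?e 0) = 0"
      using S0_pow_e[OF zero, of "Suc k"] eL[OF zero] by (intro V_Suc[OF u, of _ "?e 0"]) simp_all
    ultimately show ?thesis
      using u V_L2[of "Suc k"] eL[OF zero] by (auto simp: l2_inner_simps)
  qed
  have V_less: "l2_inner \<mu> u v = 0" if u: "u \<in> V (Suc j)" and v: "v \<in> V (Suc k)" and "j < k" for j k u v
  proof -
    obtain x where x: "x \<in> L2 \<mu>" "v = (S0 ^^ k) (S1 x)"
      using v by (auto simp: V_def)
    \<comment> \<open>Because j < k, at least j + 1 factors \<open>S0\<close> can be split off from
      \<open>v\<close>.\<close>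
    have "k = Suc j + (k - Suc j)" using \<open>j < k\<close> by simp
    then have "v = (S0 ^^ Suc j) ((S0 ^^ (k - Suc j)) (S1 x))"
      using x(2) by (metis comp_apply funpow_add)
    then show ?thesis
      using l2_isometryD(1)[OF l2_isometry_comp[OF l2_isometry_funpow[OF S0] S1] x(1)]
      by (intro V_Suc[OF u]) simp_all
  qed
  have V_orth: "l2_inner \<mu> u v = 0" if "i \<noteq> j" "u \<in> V i" "v \<in> V j" for i j u v
  proof -
    \<comment> \<open>\<open>V_0\<close> and \<open>V_less\<close> each treat one order of the
      indices; conjugate symmetry supplies the other.\<close>
    have "l2_inner \<mu> u v = 0 \<or> l2_inner \<mu> v u = 0"
      using that V_0 V_less by (cases i; cases j) (auto simp: nat_neq_iff)
    then show ?thesis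
      using l2_inner_commute[of \<mu> u v] by auto
  qed
  \<comment> \<open>Once every basis vector lies in a summand, totality of the exponentials passes
    to the algebraic sum of the summands.\<close>
  have "?e ` ?\<Gamma> \<subseteq> (\<Union>j. V j)"
  proof safe
    fix \<gamma> assume "\<gamma> \<in> ?\<Gamma>"
    then show "?e \<gamma> \<in> (\<Union>j. V j)"
    proof (cases rule: canonical_index_set_cases)
      case 1
      then have "?e \<gamma> \<in> V 0"
        using l2_span_superset[of "{?e 0}" \<mu>] by (simp add: V_def)
      then show ?thesis by blast
    next
      case (2 k \<delta>)
      have "((S0 ^^ k) \<circ> S1) (?e \<delta>) = ?e \<gamma>"
        using 2 S0_pow_e[of "real n / 2 + 2 * real n * \<delta>" k] canonical_index_set_digit[of "real n / 2" n \<delta>]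
        by (simp add: S1e)
      then have "?e \<gamma> \<in> V (Suc k)"
        unfolding V_def using eL[OF 2(1)] by (auto intro!: image_eqI[of _ _ "?e \<delta>"])
      then show ?thesis by blast
    qed
  qed
  then have "L2 \<mu> \<subseteq> l2_closure \<mu> (l2_span \<mu> (\<Union>j. V j))"
    unfolding total[symmetric] by (intro l2_closure_mono l2_span_mono)
  then have "L2 \<mu> = l2_closure \<mu> (l2_span \<mu> (\<Union>j. V j))"
    by (auto simp: l2_closure_def)
  with V_closed V_orth have "l2_orthogonal_direct_sum \<mu> (L2 \<mu>) V"
    unfolding l2_orthogonal_direct_sum_def by blast
  then show ?thesis
    unfolding V_def .
qed

end
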